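(* For every integer $n\ge1$, the fourth moment about the mean, $E[(X_n-E[X_n])^4]$, of the number $X_n$ of swaps of Quicksort for a list of length $n$ under Variant II is $$\frac1{90}n(1496n^3+5531n^2+8527n+6922)-\frac1{15}(n+1)(55n^2+85n+173)H_1(n)+\frac13(n+1)^2H_1(n)^2$$ $$+\left(-\frac13(33n^2+51n+25)(n+1)^2+2(n+1)^3H_1(n)\right)H_2(n)+3(n+1)^4H_2(n)^2-4(n+1)^3H_3(n)-6(n+1)^4H_4(n).$$
   Context: $H_k(n)=\sum_{i=1}^n \frac1{i^k}$. Variant II of Quicksort, applied to a uniformly random ordering of $n$ distinct elements: the position $i\in\{1,\dots,n\}$ of the pivot is chosen uniformly at random; each element before the pivot that is larger than the pivot is moved to the end of the list (one swap), and each element after the pivot that is smaller than the pivot is inserted before the pivot (one swap); then the procedure is applied recursively to the two sublists. $X_n$ is the total number of swaps. Formally, let $Q(n,k,i,t)$ be the probability generating function of the number of entries that are either before position $i$ and larger than $k$, or after position $i$ and smaller than $k$, in a uniformly random permutation of $\{1,\dots,n\}$ conditioned on its $i$-th entry being $k$. The probability generating function $P_n(t)=\sum_{m\ge0}P(X_n=m)t^m$ is determined by $P_0(t)=P_1(t)=1$ and $P_n(t)=\frac1{n^2}\sum_{k=1}^n\sum_{i=1}^n P_{k-1}(t)P_{n-k}(t)Q(n,k,i,t)$ for $n\ge2$. *)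

theory Defs
  imports "HOL-Probability.Probability" "HOL-Combinatorics.Permutations"
begin

definition harm_pow :: "nat \<Rightarrow> nat \<Rightarrow> real" where
  "harm_pow k n = (\<Sum>i = 1..n. 1 / real i ^ k)"

definition pgf :: "'a measure \<Rightarrow> ('a \<Rightarrow> nat) \<Rightarrow> real \<Rightarrow> real" where
  "pgf M X t = (\<Sum>m. measure M {\<omega> \<in> space M. X \<omega> = m} * t ^ m)"

text \<open>
  A list is a permutation \<open>p\<close> of \<open>{1..n}\<close>, with \<open>p j\<close> its entry at position \<open>j\<close>.
  With the pivot of value \<open>k\<close> at position \<open>i\<close>, the entries counted below are exactly those that
  one partitioning step of Variant II moves, each by one swap.
\<close>

definition step_swaps :: "nat \<Rightarrow> nat \<Rightarrow> nat \<Rightarrow> (nat \<Rightarrow> nat) \<Rightarrow> nat" where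
  "step_swaps n k i p = card {j \<in> {1..n}. (j < i \<and> k < p j) \<or> (i < j \<and> p j < k)}"

definition perm_with_entry :: "nat \<Rightarrow> nat \<Rightarrow> nat \<Rightarrow> (nat \<Rightarrow> nat) pmf" where
  "perm_with_entry n k i = cond_pmf (pmf_of_set {p. p permutes {1..n}}) {p. p i = k}"

definition step_pgf :: "nat \<Rightarrow> nat \<Rightarrow> nat \<Rightarrow> real \<Rightarrow> real" where
  "step_pgf n k i t = pgf (measure_pmf (perm_with_entry n k i)) (step_swaps n k i) t"

fun swaps_pgf :: "nat \<Rightarrow> real \<Rightarrow> real" where
  "swaps_pgf n t =
     (if n \<le> 1 then 1
      else 1 / real n ^ 2 *
        (\<Sum>k = 1..n. \<Sum>i = 1..n. swaps_pgf (k - 1) t * swaps_pgf (n - k) t * step_pgf n k i t))"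

declare swaps_pgf.simps [simp del]

text \<open>
  The number of swaps \<open>X\<^sub>n\<close> is specified by its distribution: it is any random variable
  whose probability generating function is \<open>swaps_pgf n\<close>. On \<open>[0, 1]\<close> the series
  defining \<open>pgf\<close> converges for every random variable, and its values there determine the
  distribution.
\<close>

definition is_swap_count :: "'a measure \<Rightarrow> ('a \<Rightarrow> nat) \<Rightarrow> nat \<Rightarrow> bool" where
  "is_swap_count M X n \<longleftrightarrow>
     prob_space M \<and> X \<in> measurable M (count_space UNIV) \<and>
     (\<forall>t \<in> {0..1}. pgf M X t = swaps_pgf n t)"

text \<open>Such a random variable exists for every \<open>n\<close>.\<close>

lemma pgf_finite_support:
  assumes "finite (set_pmf q)"
  shows "pgf (measure_pmf q) X t = measure_pmf.expectation q (\<lambda>\<omega>. t ^ X \<omega>)"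
proof -
  have eq: "measure (measure_pmf q) {\<omega>. X \<omega> = m} = pmf (map_pmf X q) m" for m
    by (simp add: pmf_map vimage_def)
  have "pgf (measure_pmf q) X t = (\<Sum>m. pmf (map_pmf X q) m * t ^ m)"
    by (simp add: pgf_def eq)
  also have "\<dots> = (\<Sum>m \<in> set_pmf (map_pmf X q). pmf (map_pmf X q) m * t ^ m)"
    using assms by (intro suminf_finite) (auto simp: pmf_eq_0_set_pmf)
  also have "\<dots> = measure_pmf.expectation (map_pmf X q) (\<lambda>m. t ^ m)"
    using assms by (subst integral_measure_pmf[of "set_pmf (map_pmf X q)"]) auto
  finally show ?thesis by simp
qed

lemma finite_perm_with_entry:
  assumes "k \<in> {1..n}" "i \<in> {1..n}"
  shows "finite (set_pmf (perm_with_entry n k i))"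
proof -
  let ?S = "{p. p permutes {1..n}}"
  have fin: "finite ?S" by (simp add: finite_permutations)
  have ne: "?S \<noteq> {}" using permutes_id by blast
  have "Transposition.transpose i k \<in> ?S \<inter> {p. p i = k}"
    using permutes_swap_id[OF assms(2,1)] by simp
  then show ?thesis
    unfolding perm_with_entry_def using fin ne
    by (subst set_cond_pmf) (auto simp: set_pmf_of_set)
qed

lemma ex_swap_count_pmf: "\<exists>q. finite (set_pmf q) \<and> (\<forall>t. pgf (measure_pmf q) (\<lambda>x. x) t = swaps_pgf n t)"
proof (induction n rule: less_induct)
  case (less n)
  show ?case
  proof (cases "n \<le> 1")
    case True
    have "pgf (measure_pmf (return_pmf 0)) (\<lambda>x. x) t = swaps_pgf n t" for t
      using True by (subst pgf_finite_support) (auto simp: swaps_pgf.simps)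
    then show ?thesis by (intro exI[of _ "return_pmf 0"]) auto
  next
    case False
    from less obtain q where fin: "\<And>m. m < n \<Longrightarrow> finite (set_pmf (q m))"
      and q: "\<And>m t. m < n \<Longrightarrow> pgf (measure_pmf (q m)) (\<lambda>x. x) t = swaps_pgf m t"
      by metis
    have ex: "measure_pmf.expectation (q m) (\<lambda>x. t ^ x) = swaps_pgf m t" if "m < n" for m t
      using pgf_finite_support[OF fin[OF that], of "\<lambda>x. x" t] q[OF that] by simp
    define step where "step k i = map_pmf (step_swaps n k i) (perm_with_entry n k i)" for k i
    have fstep: "finite (set_pmf (step k i))" if "k \<in> {1..n}" "i \<in> {1..n}" for k i
      using finite_perm_with_entry[OF that] by (simp add: step_def)
    have exstep: "measure_pmf.expectation (step k i) (\<lambda>x. t ^ x) = step_pgf n k i t"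
      if "k \<in> {1..n}" "i \<in> {1..n}" for k i t
      using pgf_finite_support[OF finite_perm_with_entry[OF that]]
      by (simp add: step_def step_pgf_def)
    have bind2: "finite (set_pmf (bind_pmf u (\<lambda>x. map_pmf ((+) x) v))) \<and>
        measure_pmf.expectation (bind_pmf u (\<lambda>x. map_pmf ((+) x) v)) (\<lambda>x. t ^ x) =
        measure_pmf.expectation u (\<lambda>x. t ^ x) * measure_pmf.expectation v (\<lambda>x. t ^ x)"
      if "finite (set_pmf u)" "finite (set_pmf v)" for u v :: "nat pmf" and t :: real
    proof -
      have "measure_pmf.expectation (bind_pmf u (\<lambda>x. map_pmf ((+) x) v)) (\<lambda>x. t ^ x) =
          (\<Sum>a\<in>set_pmf u. pmf u a *\<^sub>R
             measure_pmf.expectation (map_pmf ((+) a) v) (\<lambda>x. t ^ x))"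
        using that by (intro pmf_expectation_bind) auto
      also have "\<dots> = (\<Sum>a\<in>set_pmf u. t ^ a * pmf u a) * measure_pmf.expectation v (\<lambda>x. t ^ x)"
        by (simp add: power_add sum_distrib_left mult_ac)
      also have "(\<Sum>a\<in>set_pmf u. t ^ a * pmf u a) = measure_pmf.expectation u (\<lambda>x. t ^ x)"
        using that by (subst integral_measure_pmf[of "set_pmf u"]) (auto simp: mult_ac)
      finally show ?thesis using that by auto
    qed
    define add where "add u v = bind_pmf u (\<lambda>x. map_pmf ((+) x) v)" for u v :: "nat pmf"
    define r where "r = bind_pmf (pmf_of_set ({1..n} \<times> {1..n}))
      (\<lambda>(k, i). add (add (q (k - 1)) (q (n - k))) (step k i))"
    have fadd: "finite (set_pmf (add u v))" if "finite (set_pmf u)" "finite (set_pmf v)" for u v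
      using bind2[OF that] by (simp add: add_def)
    have eadd: "measure_pmf.expectation (add u v) (\<lambda>x. t ^ x) =
        measure_pmf.expectation u (\<lambda>x. t ^ x) * measure_pmf.expectation v (\<lambda>x. t ^ x)"
      if "finite (set_pmf u)" "finite (set_pmf v)" for u v and t :: real
      using bind2[OF that] by (simp add: add_def)
    have ne: "{1..n} \<times> {1..n} \<noteq> {}" using False by auto
    have fr: "finite (set_pmf r)"
      using ne by (auto simp: r_def set_pmf_of_set intro!: fadd fin fstep)
    have "pgf (measure_pmf r) (\<lambda>x. x) t = swaps_pgf n t" for t
    proof -
      have "pgf (measure_pmf r) (\<lambda>x. x) t = measure_pmf.expectation r (\<lambda>x. t ^ x)"
        using pgf_finite_support[OF fr, of "\<lambda>x. x"] by simp
      also have "\<dots> = (\<Sum>a\<in>{1..n} \<times> {1..n}. pmf (pmf_of_set ({1..n} \<times> {1..n})) a *\<^sub>R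
          measure_pmf.expectation (case a of (k, i) \<Rightarrow>
            add (add (q (k - 1)) (q (n - k))) (step k i)) (\<lambda>x. t ^ x))"
        unfolding r_def using ne
        by (intro pmf_expectation_bind) (auto simp: set_pmf_of_set intro!: fadd fin fstep)
      also have "\<dots> = (\<Sum>(k, i)\<in>{1..n} \<times> {1..n}. 1 / real n ^ 2 *
          (swaps_pgf (k - 1) t * swaps_pgf (n - k) t * step_pgf n k i t))"
      proof (rule sum.cong[OF refl], clarify)
        fix k i assume ki: "k \<in> {1..n}" "i \<in> {1..n}"
        have "pmf (pmf_of_set ({1..n} \<times> {1..n})) (k, i) = 1 / real n ^ 2"
          using ne ki by (subst pmf_of_set) (auto simp: power2_eq_square)
        moreover have lt: "k - 1 < n" "n - k < n" using ki by auto
        have "measure_pmf.expectation (add (add (q (k - 1)) (q (n - k))) (step k i)) (\<lambda>x. t ^ x) =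
            swaps_pgf (k - 1) t * swaps_pgf (n - k) t * step_pgf n k i t"
          by (simp only: eadd fadd fin lt fstep[OF ki] ex exstep[OF ki])
        ultimately show "pmf (pmf_of_set ({1..n} \<times> {1..n})) (k, i) *\<^sub>R
            measure_pmf.expectation (add (add (q (k - 1)) (q (n - k))) (step k i)) (\<lambda>x. t ^ x) =
          1 / real n ^ 2 * (swaps_pgf (k - 1) t * swaps_pgf (n - k) t * step_pgf n k i t)"
          by simp
      qed
      also have "\<dots> = swaps_pgf n t"
        using False
        by (subst swaps_pgf.simps) (simp add: sum.cartesian_product[symmetric] sum_distrib_left)
      finally show ?thesis .
    qed
    with fr show ?thesis by blast
  qed
qed

lemma ex_is_swap_count: "\<exists>q. is_swap_count (measure_pmf q) (\<lambda>x. x) n"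
  using ex_swap_count_pmf[of n] by (auto simp: is_swap_count_def measure_pmf.prob_space_axioms)

end

theory Submission
  imports Defs
begin

text \<open>
  Write \<open>P\<^sub>n\<close> for the probability generating function of \<open>X\<^sub>n\<close>. The fourth central moment is a
  polynomial in the binomial moments \<open>E[X\<^sub>n choose r]\<close>, \<open>r \<le> 4\<close>, and these are the coefficients of
  \<open>P\<^sub>n(1 + x)\<close> as a polynomial in \<open>x\<close>. They can be computed in closed form for the following reasons.

  \<^item> One partitioning step is simple after averaging over the position of the pivot. An entry
    causes a swap iff it stands on the wrong side of the pivot; the coefficient of \<open>x^c\<close> counts the sets
    of \<open>c\<close> such entries. A set \<open>D\<close> of entries larger and a set \<open>E\<close> of entries smaller than the pivot
    all cause swaps iff \<open>D\<close> precedes and \<open>E\<close> follows the pivot, which has probability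
    \<open>d! e! / (d + e + 1)!\<close> for \<open>d = |D|\<close> and \<open>e = |E|\<close> (\<open>card_permutes_separated\<close>).
    Hence the averaged step has the coefficients \<open>(l choose d) (j choose e) d! e! / (d + e + 1)!\<close>,
    with \<open>l\<close> larger and \<open>j\<close> smaller entries (\<open>average_step_pgf\<close>).

  \<^item> These coefficients are products of falling factorials of \<open>l\<close> and \<open>j\<close>, up to a factor that
    depends on \<open>d + e\<close> only. So the recurrence for \<open>P\<^sub>n\<close> becomes a differential equation for the
    generating functions \<open>F\<^sub>r(z)\<close> of the binomial moments: \<open>F\<^sub>r'\<close> is a sum of products of
    \<open>z^d D^d F\<^sub>a\<close> and \<open>z^e D^e F\<^sub>b\<close> with \<open>a + b + d + e = r\<close> (\<open>fps_deriv_choose_gf\<close>).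
    For \<open>r \<ge> 1\<close> it is linear in \<open>F\<^sub>r\<close> once \<open>F\<^sub>0, ..., F\<^sub>r\<^sub>-\<^sub>1\<close> are known, and \<open>F\<^sub>0 = 1 / (1 - z)\<close>.

  \<^item> With \<open>u = 1 / (1 - z)\<close> and \<open>L = - ln (1 - z)\<close>, the ring of polynomials in \<open>u\<close> and \<open>L\<close> is closed
    under \<open>D\<close> (\<open>Du = u\<^sup>2\<close>, \<open>DL = u\<close>) and under all \<open>z^d D^d\<close>. The solutions \<open>F\<^sub>1, ..., F\<^sub>4\<close> lie in it, so
    that each of them is verified by one polynomial identity (\<open>choose_gf_1\<close> to \<open>choose_gf_4\<close>).

  \<^item> The coefficient of \<open>z^n\<close> in \<open>u L^b\<close> is \<open>b!\<close> times the \<open>b\<close>-th elementary symmetric polynomial of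
    \<open>1, 1/2, ..., 1/n\<close>, hence a polynomial in the harmonic sums \<open>H\<^sub>k(n)\<close> (\<open>geom_lgs_nth\<close>); higher
    powers of \<open>u\<close> reduce to these (\<open>geom_power_lgs_nth\<close>).
\<close>

unbundle no vec_syntax
unbundle fps_syntax

section \<open>One partitioning step\<close>

text \<open>
  By symmetry each of the \<open>card D + 1\<close> elements of \<open>insert k D\<close> is equally often the one at which
  \<open>\<sigma>\<close> is largest: composing with a transposition exchanges the roles of two of them.
\<close>

lemma card_permutes_max_at:
  fixes A D :: "nat set"
  assumes "finite A" "k \<in> A" "D \<subseteq> A - {k}"
  shows "(card D + 1) * card {\<sigma>. \<sigma> permutes A \<and> (\<forall>y\<in>D. \<sigma> y < \<sigma> k)} = fact (card A)"
proof -
  define U where "U = insert k D"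
  define T where "T x = {\<sigma>. \<sigma> permutes A \<and> (\<forall>y\<in>U-{x}. \<sigma> y < \<sigma> x)}" for x
  have finU: "finite U" and UA: "U \<subseteq> A" and finD: "finite D"
    using assms by (auto simp: U_def intro: finite_subset)
  have finT: "finite (T x)" for x
    by (rule finite_subset[OF _ finite_permutations[OF assms(1)]]) (auto simp: T_def)
  have swap: "\<sigma> \<circ> Transposition.transpose x y \<in> T y" if "\<sigma> \<in> T x" "x \<in> U" "y \<in> U" for \<sigma> x y
  proof -
    have "(\<sigma> \<circ> Transposition.transpose x y) permutes A"
      using that UA by (intro permutes_compose permutes_swap_id) (auto simp: T_def)
    moreover have "\<sigma> (Transposition.transpose x y z) < \<sigma> x" if "z \<in> U - {y}" for z
      using \<open>\<sigma> \<in> T x\<close> \<open>x \<in> U\<close> \<open>y \<in> U\<close> that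
      by (cases "z = x") (auto simp: T_def transpose_apply_other)
    ultimately show ?thesis by (auto simp: T_def)
  qed
  have cardT: "card (T x) = card (T k)" if "x \<in> U" for x
  proof (rule bij_betw_same_card)
    show "bij_betw (\<lambda>\<sigma>. \<sigma> \<circ> Transposition.transpose x k) (T x) (T k)"
      using that swap[of _ x k] swap[of _ k x]
      by (intro bij_betwI[where g = "\<lambda>\<sigma>. \<sigma> \<circ> Transposition.transpose x k"])
        (auto simp: U_def comp_assoc transpose_commute)
  qed
  have "{\<sigma>. \<sigma> permutes A} = (\<Union>x\<in>U. T x)"
  proof (intro equalityI subsetI)
    fix \<sigma> assume "\<sigma> \<in> {\<sigma>. \<sigma> permutes A}"
    then have \<sigma>: "\<sigma> permutes A" by simp
    have ne: "U \<noteq> {}" by (simp add: U_def)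
    have "Max (\<sigma> ` U) \<in> \<sigma> ` U" using finU ne by (intro Max_in) auto
    then obtain x where x: "x \<in> U" "\<sigma> x = Max (\<sigma> ` U)" by auto
    have "\<sigma> y < \<sigma> x" if "y \<in> U - {x}" for y
    proof -
      have "\<sigma> y \<le> \<sigma> x" using x finU that by auto
      moreover have "\<sigma> y \<noteq> \<sigma> x" using that permutes_inj[OF \<sigma>] by (auto dest: injD)
      ultimately show ?thesis by simp
    qed
    then have "\<sigma> \<in> T x" using \<sigma> by (simp add: T_def)
    with x(1) show "\<sigma> \<in> (\<Union>x\<in>U. T x)" by blast
  qed (auto simp: T_def)
  then have "fact (card A) = card (\<Union>x\<in>U. T x)"
    using card_permutations[OF refl assms(1)] by simp
  also have "\<dots> = (\<Sum>x\<in>U. card (T x))"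
  proof (rule card_UN_disjoint[OF finU])
    show "\<forall>x\<in>U. \<forall>y\<in>U. x \<noteq> y \<longrightarrow> T x \<inter> T y = {}"
      by (auto simp: T_def) (metis DiffI less_asym singletonD)
  qed (auto simp: finT)
  also have "\<dots> = card U * card (T k)" by (simp add: cardT)
  also have "card U = card D + 1" using assms(3) finD by (subst U_def, subst card_insert_disjoint) auto
  also have "T k = {\<sigma>. \<sigma> permutes A \<and> (\<forall>y\<in>D. \<sigma> y < \<sigma> k)}"
    using assms by (auto simp: T_def U_def)
  finally show ?thesis by simp
qed

text \<open>
  For \<open>y\<close> outside \<open>D\<close>, \<open>E\<close> and \<open>{k}\<close>, the permutations counted for \<open>(D, E)\<close> split into those counted
  for \<open>(D, insert y E)\<close> and for \<open>(insert y D, E)\<close>, as \<open>\<sigma> y\<close> lies on one side of \<open>\<sigma> k\<close>. This recurrence,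
  which is also that of the Beta integral of \<open>p^d (1 - p)^e\<close>, reduces the claim to \<open>E = {}\<close>.
\<close>

lemma card_permutes_separated:
  fixes A D E :: "nat set"
  assumes "finite A" "k \<in> A" "D \<subseteq> A - {k}" "E \<subseteq> A - {k}" "D \<inter> E = {}"
  shows "real (card {\<sigma>. \<sigma> permutes A \<and> (\<forall>y\<in>D. \<sigma> y < \<sigma> k) \<and> (\<forall>y\<in>E. \<sigma> k < \<sigma> y)}) =
    fact (card A) * (fact (card D) * fact (card E) / fact (card D + card E + 1))"
proof -
  have "finite E" using assms by (auto intro: finite_subset)
  then show ?thesis using assms(3-5)
  proof (induction E arbitrary: D rule: finite_induct)
    case empty
    have "real ((card D + 1) * card {\<sigma>. \<sigma> permutes A \<and> (\<forall>y\<in>D. \<sigma> y < \<sigma> k)}) =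
        real (fact (card A))"
      by (subst card_permutes_max_at[OF assms(1,2) empty(1)]) simp
    then have "(real (card D) + 1) * real (card {\<sigma>. \<sigma> permutes A \<and> (\<forall>y\<in>D. \<sigma> y < \<sigma> k)}) =
        fact (card A)"
      by (simp only: of_nat_mult of_nat_add of_nat_1 of_nat_fact)
    then show ?case by (simp add: nonzero_eq_divide_eq mult.commute add.commute)
  next
    case (insert y E)
    let ?N = "\<lambda>D E. {\<sigma>. \<sigma> permutes A \<and> (\<forall>y\<in>D. \<sigma> y < \<sigma> k) \<and> (\<forall>y\<in>E. \<sigma> k < \<sigma> y)}"
    have fin: "finite (?N D E)" for D E
      by (rule finite_subset[OF _ finite_permutations[OF assms(1)]]) auto
    have finD: "finite D" using insert.prems assms(1) by (auto intro: finite_subset)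
    have "?N D E = ?N D (insert y E) \<union> ?N (insert y D) E"
    proof -
      have "\<sigma> k < \<sigma> y \<or> \<sigma> y < \<sigma> k" if "\<sigma> permutes A" for \<sigma>
        using injD[OF permutes_inj[OF that], of k y] insert.prems by force
      then show ?thesis by auto
    qed
    moreover have "?N D (insert y E) \<inter> ?N (insert y D) E = {}" by auto
    ultimately have "card (?N D E) = card (?N D (insert y E)) + card (?N (insert y D) E)"
      using card_Un_disjoint[OF fin fin, of D "insert y E" "insert y D" E] by argo
    moreover have "real (card (?N D E)) =
        fact (card A) * (fact (card D) * fact (card E) / fact (card D + card E + 1))"
      using insert.prems by (intro insert.IH) auto
    moreover have "real (card (?N (insert y D) E)) = fact (card A) *
        (fact (card (insert y D)) * fact (card E) / fact (card (insert y D) + card E + 1))"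
      using insert.prems insert.hyps by (intro insert.IH) auto
    moreover have "card (insert y D) = card D + 1" "card (insert y E) = card E + 1"
      using insert.prems insert.hyps finD by auto
    moreover have "fact (card D) * fact (Suc (card E)) / fact (card D + card E + 2) =
        (fact (card D) * fact (card E) / fact (card D + card E + 1) -
         fact (Suc (card D)) * fact (card E) / fact (card D + card E + 2) :: real)"
    proof -
      have split: "(fact (card D + card E + 2) :: real) =
          (real (card D) + real (card E) + 2) * fact (card D + card E + 1)"
        by (simp add: algebra_simps)
      show ?thesis unfolding split by (simp add: divide_simps del: fact_Suc) (simp add: algebra_simps)
    qed
    ultimately show ?case by (simp add: right_diff_distrib del: fact_Suc)
  qed
qed

lemma sum_Pow_card:
  fixes h :: "nat \<Rightarrow> real"
  assumes "finite A"
  shows "(\<Sum>X\<in>Pow A. h (card X)) = (\<Sum>d\<le>card A. real (card A choose d) * h d)"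
proof -
  have "(\<Sum>X\<in>Pow A. h (card X)) = (\<Sum>d\<le>card A. \<Sum>X\<in>{X\<in>Pow A. card X = d}. h (card X))"
    using assms by (intro sum.group[symmetric]) (auto intro: card_mono)
  also have "\<dots> = (\<Sum>d\<le>card A. real (card A choose d) * h d)"
    by (intro sum.cong refl) (simp add: n_subsets[OF assms] Pow_def)
  finally show ?thesis .
qed

text \<open>
  The generating function, in the variable \<open>x = t - 1\<close>, of the swaps in one partitioning step with
  \<open>l\<close> entries larger and \<open>j\<close> entries smaller than the pivot, averaged over the pivot position.
\<close>

definition step_poly :: "nat \<Rightarrow> nat \<Rightarrow> real poly" where
  "step_poly l j = (\<Sum>d\<le>l. \<Sum>e\<le>j.
     monom (real (l choose d) * real (j choose e) * (fact d * fact e / fact (d + e + 1))) (d + e))"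

text \<open>
  All values at position \<open>i\<close> are equally frequent: composing with a transposition of two values
  exchanges the corresponding sets of permutations.
\<close>

lemma card_permutes_fixing:
  assumes "k \<in> {1..n}" "i \<in> {1..n}"
  shows "card {p. p permutes {1..n} \<and> p i = k} = fact (n - 1)"
proof -
  let ?S = "\<lambda>v. {p. p permutes {1..n} \<and> p i = v}"
  have move: "Transposition.transpose v w \<circ> p \<in> ?S w" if "p \<in> ?S v" "v \<in> {1..n}" "w \<in> {1..n}" for p v w
    using that by (auto intro!: permutes_compose permutes_swap_id)
  have same: "card (?S v) = card (?S k)" if "v \<in> {1..n}" for v
  proof (rule bij_betw_same_card)
    show "bij_betw (\<lambda>p. Transposition.transpose v k \<circ> p) (?S v) (?S k)"
      using that assms(1) move[of _ v k] move[of _ k v]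
      by (intro bij_betwI[where g = "\<lambda>p. Transposition.transpose v k \<circ> p"])
        (auto simp: comp_assoc[symmetric] transpose_commute)
  qed
  have "fact n = card {p. p permutes {1..n}}"
    by (subst card_permutations[of "{1..n}" n]) auto
  also have "\<dots> = (\<Sum>v\<in>{1..n}. card {p\<in>{p. p permutes {1..n}}. p i = v})"
    using assms permutes_in_image[of _ "{1..n}" i]
    unfolding card_eq_sum by (intro sum.group[symmetric] finite_permutations) auto
  also have "\<dots> = n * card (?S k)"
    using same by (simp add: sum.cong)
  finally have "n * fact (n - 1) = n * card (?S k)"
    using assms by (cases n) auto
  then show ?thesis using assms by simp
qed

lemma step_pgf_eq:
  assumes "k \<in> {1..n}" "i \<in> {1..n}"
  shows "step_pgf n k i t =
    (\<Sum>p | p permutes {1..n} \<and> p i = k. t ^ step_swaps n k i p) / fact (n - 1)"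
proof -
  let ?S = "{p. p permutes {1..n}}" and ?T = "{p. p permutes {1..n} \<and> p i = k}"
  have fin: "finite ?S" by (simp add: finite_permutations)
  have "card ?T \<noteq> 0" using card_permutes_fixing[OF assms] by simp
  then have ne: "?T \<noteq> {}" and finT: "finite ?T" by (auto simp: card_eq_0_iff)
  have T: "?T = ?S \<inter> {p. p i = k}" by auto
  have ne': "?S \<noteq> {}" "?S \<inter> {p. p i = k} \<noteq> {}" using ne by blast+
  have "perm_with_entry n k i = pmf_of_set ?T"
    unfolding perm_with_entry_def T
    using ne' fin
    by (intro pmf_eqI, subst pmf_cond)
      (auto simp: set_pmf_of_set measure_pmf_of_set pmf_of_set indicator_def)
  then show ?thesis
    unfolding step_pgf_def
    using ne finT card_permutes_fixing[OF assms]
    by (subst pgf_finite_support) (auto simp: integral_pmf_of_set)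
qed

text \<open>
  Averaging over the pivot position \<open>i\<close> removes the conditioning: the sum runs over all
  permutations, and \<open>i\<close> is the position \<open>\<sigma> k\<close> where \<open>\<sigma>\<close> is the inverse permutation. Then
  \<open>(1 + x)^m\<close> is expanded as a sum over the subsets of the \<open>m\<close> moved values, and for each pair of a set
  \<open>D\<close> of large and a set \<open>E\<close> of small values the permutations that move all of them are counted.
\<close>

lemma average_step_pgf:
  assumes k: "k \<in> {1..n}"
  shows "(\<Sum>i = 1..n. step_pgf n k i (1 + x)) / n = poly (step_poly (n - k) (k - 1)) x"
proof -
  define \<Omega> where "\<Omega> = {\<sigma>. \<sigma> permutes {1..n}}"
  define moved where
    "moved \<sigma> = {v \<in> {k<..n}. \<sigma> v < \<sigma> k} \<union> {v \<in> {1..<k}. \<sigma> k < \<sigma> v}" for \<sigma> :: "nat \<Rightarrow> nat"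
  have fin: "finite \<Omega>" by (simp add: \<Omega>_def finite_permutations)
  \<comment> \<open>The moved positions \<open>j\<close> correspond to the moved values \<open>p j\<close>.\<close>
  have step: "step_swaps n k i p = card (moved (inv p))" if "p permutes {1..n}" "p i = k" for i p
  proof -
    have inj: "inj p" using that permutes_inj by blast
    have inv: "inv p (p j) = j" for j using inj by simp
    have rng: "p j \<in> {1..n} \<longleftrightarrow> j \<in> {1..n}" for j using that permutes_in_image by metis
    let ?C = "{j \<in> {1..n}. (j < i \<and> k < p j) \<or> (i < j \<and> p j < k)}"
    have "p ` ?C = moved (inv p)"
    proof (intro equalityI subsetI)
      fix v assume "v \<in> p ` ?C"
      then obtain j where "j \<in> ?C" "v = p j" by auto
      then show "v \<in> moved (inv p)"
        using rng[of j] inv[of j] inv[of i] that(2) by (auto simp: moved_def)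
    next
      fix v assume v: "v \<in> moved (inv p)"
      have pv: "p (inv p v) = v" using that permutes_inverses by metis
      have "inv p k = i" using inv[of i] that(2) by simp
      then have "(k < v \<and> inv p v < i) \<or> (v < k \<and> i < inv p v)" "v \<in> {1..n}"
        using v k by (auto simp: moved_def)
      moreover from this(2) have "inv p v \<in> {1..n}" using rng[of "inv p v"] pv by simp
      ultimately have "inv p v \<in> ?C" using pv by simp blast
      then show "v \<in> p ` ?C" by (intro image_eqI[of v p "inv p v"] pv[symmetric])
    qed
    moreover have "card (p ` ?C) = card ?C"
      by (intro card_image inj_on_subset[OF inj]) auto
    ultimately show ?thesis by (simp add: step_swaps_def)
  qed
  have "(\<Sum>i = 1..n. step_pgf n k i (1 + x)) =
    (\<Sum>i = 1..n. (\<Sum>\<sigma> | \<sigma> \<in> \<Omega> \<and> \<sigma> k = i. (1 + x) ^ card (moved \<sigma>)) / fact (n - 1))"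
  proof (intro sum.cong refl)
    fix i assume i: "i \<in> {1..n}"
    have "(\<Sum>p | p permutes {1..n} \<and> p i = k. (1 + x) ^ step_swaps n k i p) =
        (\<Sum>\<sigma> | \<sigma> \<in> \<Omega> \<and> \<sigma> k = i. (1 + x) ^ card (moved \<sigma>))"
      by (rule sum.reindex_bij_witness[where i = inv and j = inv])
        (auto simp: \<Omega>_def step permutes_inv permutes_inv_inv permutes_inv_eq)
    then show "step_pgf n k i (1 + x) =
        (\<Sum>\<sigma> | \<sigma> \<in> \<Omega> \<and> \<sigma> k = i. (1 + x) ^ card (moved \<sigma>)) / fact (n - 1)"
      by (simp add: step_pgf_eq[OF k i])
  qed
  also have "\<dots> = (\<Sum>\<sigma>\<in>\<Omega>. (1 + x) ^ card (moved \<sigma>)) / fact (n - 1)"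
    unfolding sum_divide_distrib[symmetric]
    using k permutes_in_image[of _ "{1..n}" k]
    by (subst sum.group[OF fin]) (auto simp: \<Omega>_def)
  \<comment> \<open>A subset of \<open>moved \<sigma>\<close> consists of a set \<open>D\<close> of large and a set \<open>E\<close> of small values.\<close>
  also have "(\<Sum>\<sigma>\<in>\<Omega>. (1 + x) ^ card (moved \<sigma>)) = (\<Sum>\<sigma>\<in>\<Omega>. \<Sum>D\<in>Pow {k<..n}. \<Sum>E\<in>Pow {1..<k}.
      if (\<forall>y\<in>D. \<sigma> y < \<sigma> k) \<and> (\<forall>y\<in>E. \<sigma> k < \<sigma> y) then x ^ (card D + card E) else 0)"
  proof (intro sum.cong refl)
    fix \<sigma> :: "nat \<Rightarrow> nat"
    let ?B = "{v \<in> {k<..n}. \<sigma> v < \<sigma> k}" and ?C = "{v \<in> {1..<k}. \<sigma> k < \<sigma> v}"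
    have pow: "(1 + x) ^ card F = (\<Sum>D\<in>Pow F. x ^ card D)" if "finite F" for F :: "nat set"
      using prod_add[OF that, of "\<lambda>_. x" "\<lambda>_. 1"] by (simp add: add.commute)
    have sub: "(\<Sum>D\<in>Pow {v \<in> F. P v}. g D) = (\<Sum>D\<in>Pow F. if \<forall>y\<in>D. P y then g D else 0)"
      if "finite F" for F :: "nat set" and P and g :: "nat set \<Rightarrow> real"
      using that by (intro sum.mono_neutral_cong_left) auto
    have "card (moved \<sigma>) = card ?B + card ?C"
      unfolding moved_def by (intro card_Un_disjoint) auto
    then have "(1 + x) ^ card (moved \<sigma>) =
        (\<Sum>D\<in>Pow ?B. x ^ card D) * (\<Sum>E\<in>Pow ?C. x ^ card E)"
      by (simp add: power_add pow)
    also have "\<dots> = (\<Sum>D\<in>Pow {k<..n}. \<Sum>E\<in>Pow {1..<k}.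
      if (\<forall>y\<in>D. \<sigma> y < \<sigma> k) \<and> (\<forall>y\<in>E. \<sigma> k < \<sigma> y) then x ^ (card D + card E) else 0)"
      by (subst (1 2) sub) (auto simp: sum_product power_add intro!: sum.cong)
    finally show "(1 + x) ^ card (moved \<sigma>) = \<dots>" .
  qed
  also have "\<dots> = (\<Sum>D\<in>Pow {k<..n}. \<Sum>E\<in>Pow {1..<k}. \<Sum>\<sigma>\<in>\<Omega>.
      if (\<forall>y\<in>D. \<sigma> y < \<sigma> k) \<and> (\<forall>y\<in>E. \<sigma> k < \<sigma> y) then x ^ (card D + card E) else 0)"
    by (subst sum.swap, intro sum.cong refl, rule sum.swap)
  also have "\<dots> = (\<Sum>D\<in>Pow {k<..n}. \<Sum>E\<in>Pow {1..<k}.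
      fact n * (fact (card D) * fact (card E) / fact (card D + card E + 1) * x ^ (card D + card E)))"
  proof (intro sum.cong refl)
    fix D E assume DE: "D \<in> Pow {k<..n}" "E \<in> Pow {1..<k}"
    have "(\<Sum>\<sigma>\<in>\<Omega>. if (\<forall>y\<in>D. \<sigma> y < \<sigma> k) \<and> (\<forall>y\<in>E. \<sigma> k < \<sigma> y) then x ^ (card D + card E) else 0) =
      real (card {\<sigma>. \<sigma> permutes {1..n} \<and> (\<forall>y\<in>D. \<sigma> y < \<sigma> k) \<and> (\<forall>y\<in>E. \<sigma> k < \<sigma> y)}) *
        x ^ (card D + card E)"
      by (subst sum.inter_filter[OF fin, symmetric]) (simp add: \<Omega>_def)
    also have "\<dots> = fact (card {1..n}) * (fact (card D) * fact (card E) /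
        fact (card D + card E + 1)) * x ^ (card D + card E)"
      using DE k by (subst card_permutes_separated) force+
    finally show "(\<Sum>\<sigma>\<in>\<Omega>. if (\<forall>y\<in>D. \<sigma> y < \<sigma> k) \<and> (\<forall>y\<in>E. \<sigma> k < \<sigma> y)
        then x ^ (card D + card E) else 0) =
      fact n * (fact (card D) * fact (card E) / fact (card D + card E + 1) * x ^ (card D + card E))"
      by simp
  qed
  also have "\<dots> = fact n * poly (step_poly (n - k) (k - 1)) x"
    by (subst sum_Pow_card, simp)+
      (simp add: step_poly_def poly_sum poly_monom sum_distrib_left mult_ac sum_Pow_card)
  also have "(fact n :: real) = n * fact (n - 1)" using k by (cases n) (auto simp: algebra_simps)
  finally show ?thesis using k by simp
qed

text \<open>
  The recurrence for \<open>swaps_pgf n (1 + x)\<close> as polynomials in \<open>x\<close>. The summation index \<open>j = k - 1\<close> is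
  the number of entries smaller than the pivot. At \<open>n = 1\<close> it gives the same value \<open>1\<close>
  as the case distinction of \<open>swaps_pgf\<close>.
\<close>

fun swaps_poly :: "nat \<Rightarrow> real poly" where
  "swaps_poly n = (if n = 0 then 1 else
     smult (1 / n) (\<Sum>j<n. swaps_poly j * swaps_poly (n - 1 - j) * step_poly (n - 1 - j) j))"

declare swaps_poly.simps [simp del]

lemma poly_swaps_poly: "poly (swaps_poly n) x = swaps_pgf n (1 + x)"
proof (induction n rule: less_induct)
  case (less n)
  consider "n = 0" | "n = 1" | "n \<ge> 2" by linarith
  then show ?case
  proof cases
    case 3
    have "swaps_pgf n (1 + x) = 1 / real n * (\<Sum>k = 1..n. swaps_pgf (k - 1) (1 + x) *
        swaps_pgf (n - k) (1 + x) * ((\<Sum>i = 1..n. step_pgf n k i (1 + x)) / n))"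
      using 3 by (subst swaps_pgf.simps)
        (simp add: sum_distrib_left sum_divide_distrib power2_eq_square mult_ac)
    also have "\<dots> = 1 / real n * (\<Sum>k = 1..n. poly (swaps_poly (k - 1) *
        swaps_poly (n - k) * step_poly (n - k) (k - 1)) x)"
      by (intro arg_cong2[where f = times] refl sum.cong)
        (subst average_step_pgf, simp, subst (1 2) less[symmetric], auto)
    also have "(\<Sum>k = 1..n. poly (swaps_poly (k - 1) *
        swaps_poly (n - k) * step_poly (n - k) (k - 1)) x) =
        (\<Sum>j<n. poly (swaps_poly j * swaps_poly (n - 1 - j) * step_poly (n - 1 - j) j) x)"
      by (rule sum.reindex_bij_witness[where i = Suc and j = "\<lambda>k. k - 1"]) auto
    also have "1 / real n * \<dots> = poly (swaps_poly n) x"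
      using 3 by (subst (3) swaps_poly.simps) (simp add: poly_sum)
    finally show ?thesis by simp
  qed (simp_all add: swaps_poly.simps swaps_pgf.simps step_poly_def)
qed

section \<open>Differential equations for the binomial moments\<close>

lemma coeff_step_poly:
  "coeff (step_poly l j) c =
    (\<Sum>d\<le>c. real (l choose d) * fact d * (real (j choose (c - d)) * fact (c - d))) / fact (c + 1)"
proof -
  let ?g = "\<lambda>d e. real (l choose d) * real (j choose e) * (fact d * fact e / fact (d + e + 1))"
  have "coeff (step_poly l j) c = (\<Sum>(d, e)\<in>{..l} \<times> {..j}. if d + e = c then ?g d e else 0)"
    by (auto simp: step_poly_def coeff_sum sum.cartesian_product intro!: sum.cong simp del: fact_Suc)
  also have "\<dots> = (\<Sum>(d, e)\<in>{..l} \<times> {..j} \<inter> {(d, e). d + e = c}. ?g d e)"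
    by (subst sum.inter_restrict) (auto intro!: sum.cong)
  also have "\<dots> = (\<Sum>(d, e) | d + e = c. ?g d e)"
  proof (rule sum.mono_neutral_left)
    show "finite {(d, e). d + e = c}"
      by (rule finite_subset[of _ "{..c} \<times> {..c}"]) auto
  qed (auto simp: binomial_eq_0_iff)
  also have "\<dots> = (\<Sum>d\<le>c. ?g d (c - d))"
    by (rule sum.reindex_bij_witness[where i = "\<lambda>d. (d, c - d)" and j = fst]) auto
  finally show ?thesis
    by (simp add: sum_divide_distrib mult_ac del: fact_Suc)
qed

text \<open>
  The generating functions of the binomial moments have rational coefficients as polynomials in
  \<open>1 / (1 - z)\<close> and \<open>- ln (1 - z)\<close>. For \<open>r \<le> 4\<close> these factors clear the denominators, both in the solutions and in
  the differential equations, so that only identities with integer coefficients remain.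
\<close>

definition moment_scale :: "nat \<Rightarrow> real" where
  "moment_scale r = (if r = 2 then 6 else if r = 3 then 24 else if r = 4 then 720 else 1)"

lemma moment_scale_nonzero: "moment_scale r \<noteq> 0"
  by (simp add: moment_scale_def)

definition choose_gf :: "nat \<Rightarrow> real fps" where
  "choose_gf r = Abs_fps (\<lambda>n. moment_scale r * coeff (swaps_poly n) r)"

text \<open>
  The operator \<open>z^d D^d\<close>, where \<open>D\<close> is differentiation: it multiplies the \<open>n\<close>-th coefficient by the
  falling factorial \<open>n (n - 1) ... (n - d + 1)\<close>.
\<close>

definition falling_deriv :: "nat \<Rightarrow> real fps \<Rightarrow> real fps" where
  "falling_deriv d F = Abs_fps (\<lambda>n. real (n choose d) * fact d * F $ n)"

lemma falling_deriv_0 [simp]: "falling_deriv 0 F = F"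
  by (simp add: falling_deriv_def fps_eq_iff)

text \<open>
  The rule \<open>z^(d+1) D^(d+1) = (zD - d) z^d D^d\<close>.
\<close>

lemma falling_deriv_Suc:
  "falling_deriv (Suc d) F = fps_X * fps_deriv (falling_deriv d F) - of_nat d * falling_deriv d F"
proof (rule fps_ext)
  fix n
  have "real (n choose Suc d) * fact (Suc d) = (real n - real d) * (real (n choose d) * fact d)"
  proof -
    have "Suc d * (n choose Suc d) = (n - d) * (n choose d)"
      by (metis binomial_absorb_comp binomial_absorption)
    then have "real (Suc d) * real (n choose Suc d) = real (n - d) * real (n choose d)"
      by (metis of_nat_mult)
    then show ?thesis by (cases "d \<le> n") (auto simp: of_nat_diff binomial_eq_0 mult_ac)
  qed
  then have "falling_deriv (Suc d) F $ n = real n * falling_deriv d F $ n - real d * falling_deriv d F $ n"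
    by (simp only: falling_deriv_def fps_nth_Abs_fps left_diff_distrib)
  moreover have "(fps_X * fps_deriv (falling_deriv d F)) $ n = real n * falling_deriv d F $ n"
    by (cases n) auto
  moreover have "(of_nat d * falling_deriv d F) $ n = real d * falling_deriv d F $ n"
    by (simp flip: fps_of_nat)
  ultimately show "falling_deriv (Suc d) F $ n = (fps_X * fps_deriv (falling_deriv d F) - of_nat d * falling_deriv d F) $ n"
    by simp
qed

text \<open>
  The coefficient of \<open>z^n\<close> on the left is \<open>(n + 1) E[X\<^sub>n\<^sub>+\<^sub>1 choose r]\<close>, up to the scaling factor. By the recurrence it is a
  convolution over the two sublist lengths; the weight from the partitioning step is a sum of
  products of a falling factorial of each length, and each factor is absorbed by one of the two
  generating functions.
\<close>

theorem fps_deriv_choose_gf: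
  "fps_deriv (choose_gf r) = (\<Sum>c\<le>r. \<Sum>a\<le>r - c.
     fps_const (moment_scale r / (fact (c + 1) * moment_scale a * moment_scale (r - c - a))) *
     (\<Sum>d\<le>c. falling_deriv d (choose_gf a) * falling_deriv (c - d) (choose_gf (r - c - a))))"
proof (rule fps_ext)
  fix n
  let ?f = "\<lambda>n. coeff (swaps_poly n)"
  let ?m = "\<lambda>r n. moment_scale r * coeff (swaps_poly n) r"
  let ?s = "\<lambda>l j c. (\<Sum>d\<le>c. real (l choose d) * fact d * (real (j choose (c - d)) * fact (c - d)))"
  let ?k = "\<lambda>c a. moment_scale r / (fact (c + 1) * moment_scale a * moment_scale (r - c - a))"
  have "fps_deriv (choose_gf r) $ n =
      moment_scale r * (\<Sum>j\<le>n. coeff (step_poly (n - j) j * (swaps_poly (n - j) * swaps_poly j)) r)"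
    by (simp add: choose_gf_def swaps_poly.simps[of "Suc n"] coeff_sum lessThan_Suc_atMost mult_ac)
  also have "\<dots> = (\<Sum>j\<le>n. \<Sum>c\<le>r. \<Sum>a\<le>r - c.
      moment_scale r * (?s (n - j) j c / fact (c + 1) * (?f (n - j) a * ?f j (r - c - a))))"
    by (simp only: coeff_mult coeff_step_poly sum_distrib_left)
  also have "\<dots> = (\<Sum>c\<le>r. \<Sum>a\<le>r - c. \<Sum>j\<le>n.
      moment_scale r * (?s (n - j) j c / fact (c + 1) * (?f (n - j) a * ?f j (r - c - a))))"
    by (rule trans[OF sum.swap], rule sum.cong[OF refl], rule sum.swap)
  also have "\<dots> = (\<Sum>c\<le>r. \<Sum>a\<le>r - c. ?k c a * (\<Sum>d\<le>c.
      (\<Sum>j\<le>n. real (j choose (c - d)) * fact (c - d) * ?m (r - c - a) j *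
        (real (n - j choose d) * fact d * ?m a (n - j)))))"
    (is "(\<Sum>c\<le>r. \<Sum>a\<le>r - c. ?A c a) = (\<Sum>c\<le>r. \<Sum>a\<le>r - c. ?B c a)")
  proof (intro sum.cong refl)
    fix c a
    have "?A c a = (\<Sum>j\<le>n. \<Sum>d\<le>c. ?k c a *
        (real (j choose (c - d)) * fact (c - d) * ?m (r - c - a) j *
        (real (n - j choose d) * fact d * ?m a (n - j))))"
    proof (rule sum.cong[OF refl])
      fix j
      have "moment_scale r * (?s (n - j) j c / fact (c + 1) * (?f (n - j) a * ?f j (r - c - a))) =
          ?k c a * (?s (n - j) j c * (?m (r - c - a) j * ?m a (n - j)))"
        by (simp add: moment_scale_nonzero del: fact_Suc)
      also have "\<dots> = (\<Sum>d\<le>c. ?k c a * (real (j choose (c - d)) * fact (c - d) * ?m (r - c - a) j *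
          (real (n - j choose d) * fact d * ?m a (n - j))))"
        unfolding sum_distrib_right sum_distrib_left by (intro sum.cong refl) (simp only: mult_ac)
      finally show "moment_scale r *
          (?s (n - j) j c / fact (c + 1) * (?f (n - j) a * ?f j (r - c - a))) = \<dots>" .
    qed
    also have "\<dots> = ?B c a"
      by (subst sum.swap) (simp only: sum_distrib_left)
    finally show "?A c a = ?B c a" .
  qed
  also have "\<dots> = (\<Sum>c\<le>r. \<Sum>a\<le>r - c. ?k c a * (\<Sum>d\<le>c.
      (falling_deriv (c - d) (choose_gf (r - c - a)) * falling_deriv d (choose_gf a)) $ n))"
    by (simp only: fps_mult_nth falling_deriv_def choose_gf_def atMost_atLeast0 fps_nth_Abs_fps)
  finally show "fps_deriv (choose_gf r) $ n = (\<Sum>c\<le>r. \<Sum>a\<le>r - c. fps_const (?k c a) *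
     (\<Sum>d\<le>c. falling_deriv d (choose_gf a) * falling_deriv (c - d) (choose_gf (r - c - a)))) $ n"
    by (simp add: fps_sum_nth mult.commute)
qed

text \<open>
  The difference \<open>H\<close> satisfies \<open>H' = 2 U H\<close> and vanishes at \<open>0\<close>; this equation determines every
  coefficient of \<open>H\<close> linearly from the preceding ones.
\<close>

lemma fps_linear_ode_unique:
  fixes F G :: "real fps"
  assumes "fps_deriv F = 2 * U * F + B" "fps_deriv G = 2 * U * G + B" "F $ 0 = G $ 0"
  shows "F = G"
proof (rule fps_ext)
  fix n
  have D: "fps_deriv (F - G) = 2 * U * (F - G)"
    using assms by (simp add: algebra_simps)
  have "(F - G) $ n = 0"
  proof (induction n rule: less_induct)
    case (less n)
    show ?case
    proof (cases n)
      case 0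
      then show ?thesis using assms by simp
    next
      case (Suc m)
      have "real (Suc m) * (F - G) $ Suc m = (2 * U * (F - G)) $ m"
        using arg_cong[OF D, of "\<lambda>H. H $ m"] by (simp only: fps_deriv_nth of_nat_Suc add.commute Suc_eq_plus1)
      also have "\<dots> = 0"
        using less Suc by (simp add: fps_mult_nth del: fps_sub_nth)
      finally show ?thesis using Suc by simp
    qed
  qed
  then show "F $ n = G $ n" by simp
qed

section \<open>Solutions in terms of geometric and logarithmic series\<close>

definition geom :: "real fps" where "geom = Abs_fps (\<lambda>n. 1)"

text \<open>
  The convention \<open>1 / 0 = 0\<close> gives the constant coefficient.
\<close>

definition lgs :: "real fps" where "lgs = Abs_fps (\<lambda>n. 1 / real n)"

lemma fps_X_geom: "fps_X * geom = geom - 1"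
proof (rule fps_ext)
  fix n show "(fps_X * geom) $ n = (geom - 1) $ n" by (cases n) (auto simp: geom_def)
qed

lemma fps_deriv_geom: "fps_deriv geom = geom ^ 2"
  by (rule fps_ext) (simp add: geom_def power2_eq_square fps_mult_nth)

lemma fps_deriv_lgs: "fps_deriv lgs = geom"
  by (rule fps_ext) (simp add: geom_def lgs_def)

text \<open>
  The Euler operator \<open>zD\<close>. Unlike \<open>D\<close> and \<open>z\<close> taken separately, it maps polynomials in
  \<open>geom = 1 / (1 - z)\<close> and \<open>lgs = - ln (1 - z)\<close> to such polynomials by rules that do not mention \<open>z\<close>.
\<close>

definition theta :: "real fps \<Rightarrow> real fps" where "theta F = fps_X * fps_deriv F"

lemma theta_nth: "theta F $ n = real n * F $ n"
  by (cases n) (simp_all add: theta_def)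

lemma theta_simps:
  "theta (F + G) = theta F + theta G"
  "theta (F - G) = theta F - theta G"
  "theta (- F) = - theta F"
  "theta (F * G) = theta F * G + F * theta G"
  "theta 1 = 0" "theta 0 = 0"
  "theta (numeral k) = 0"
  "theta (F ^ m) = of_nat m * F ^ (m - 1) * theta F"
  by (simp_all add: theta_def algebra_simps fps_deriv_power flip: fps_of_nat)

lemma theta_geom: "theta geom = geom * (geom - 1)"
  by (simp add: theta_def fps_deriv_geom power2_eq_square mult.assoc[symmetric] fps_X_geom)

lemma theta_lgs: "theta lgs = geom - 1"
  by (simp add: theta_def fps_deriv_lgs fps_X_geom)

lemma falling_deriv_Suc_theta:
  "falling_deriv (Suc d) F = theta (falling_deriv d F) - of_nat d * falling_deriv d F"
  by (simp add: theta_def falling_deriv_Suc)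

lemma choose_gf_0: "choose_gf 0 = geom"
proof -
  have "coeff (swaps_poly n) 0 = 1" for n
  proof (induction n rule: less_induct)
    case (less n)
    have 1: "coeff (step_poly l j) 0 = 1" for l j by (simp add: coeff_step_poly)
    show ?case using less
      by (subst swaps_poly.simps) (simp add: coeff_sum coeff_mult 1)
  qed
  then show ?thesis by (simp add: choose_gf_def geom_def moment_scale_def)
qed

lemma choose_gf_at_0: "r > 0 \<Longrightarrow> choose_gf r $ 0 = 0"
  by (simp add: choose_gf_def swaps_poly.simps coeff_1)

lemma falling_deriv_1: "falling_deriv 1 F = theta F"
  using falling_deriv_Suc_theta[of 0 F] by simp

lemma falling_deriv_2: "falling_deriv 2 F = theta (theta F) - theta F"
  by (simp add: numeral_2_eq_2 falling_deriv_Suc_theta)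

lemma falling_deriv_3: "falling_deriv 3 F = theta (falling_deriv 2 F) - 2 * falling_deriv 2 F"
  using falling_deriv_Suc_theta[of 2 F] by (simp add: numeral_3_eq_3)

lemma falling_deriv_4: "falling_deriv 4 F = theta (falling_deriv 3 F) - 3 * falling_deriv 3 F"
  using falling_deriv_Suc_theta[of 3 F] by simp

lemmas choose_gf_ode = fps_deriv_choose_gf moment_scale_def choose_gf_0

text \<open>
  The equation \<open>F' = 2 u F + B\<close> is solved by \<open>F = u\<^sup>2 \<integral> B / u\<^sup>2\<close>, which is how the
  right-hand sides of this lemma and of the next three arise. Knowing them, it suffices to check that each
  satisfies its equation; the inhomogeneous part \<open>B\<close> collects the products of the solutions found
  before, and the check is an identity between polynomials in \<open>geom\<close> and \<open>lgs\<close>.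
\<close>

lemma choose_gf_1: "choose_gf 1 = geom^2 * lgs - geom^2 + geom"
proof (rule fps_linear_ode_unique)
  show "fps_deriv (choose_gf 1) = 2 * geom * choose_gf 1 + falling_deriv 1 geom * geom"
    by (simp add: choose_gf_ode mult_ac)
  show "fps_deriv (geom^2 * lgs - geom^2 + geom) =
      2 * geom * (geom^2 * lgs - geom^2 + geom) + falling_deriv 1 geom * geom"
    unfolding falling_deriv_1 theta_geom
    by (simp add: fps_deriv_power fps_deriv_geom fps_deriv_lgs flip: numeral_fps_const) algebra
  show "choose_gf 1 $ 0 = (geom^2 * lgs - geom^2 + geom) $ 0"
    by (simp add: choose_gf_at_0 geom_def lgs_def fps_nth_power_0)
qed

lemma choose_gf_2: "choose_gf 2 = (6 * geom^3 - 3 * geom^2) * lgs^2 + (2 * geom^2 - 6 * geom^3) * lgs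
    + (5 * geom^3 - 6 * geom^2 + geom)" (is "_ = ?G")
proof (rule fps_linear_ode_unique)
  let ?B = "6 * choose_gf 1 ^ 2 + 6 * (falling_deriv 1 geom * choose_gf 1 + geom * falling_deriv 1 (choose_gf 1))
    + (2 * falling_deriv 2 geom * geom + (falling_deriv 1 geom)^2)"
  show "fps_deriv (choose_gf 2) = 2 * geom * choose_gf 2 + ?B"
    by (simp add: choose_gf_ode numeral_2_eq_2 algebra_simps flip: numeral_fps_const)
  show "fps_deriv ?G = 2 * geom * ?G + ?B"
    unfolding choose_gf_1 falling_deriv_1 falling_deriv_2
    by (simp add: theta_simps theta_geom theta_lgs fps_deriv_power fps_deriv_geom fps_deriv_lgs flip: numeral_fps_const) algebra
  show "choose_gf 2 $ 0 = ?G $ 0"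
    by (simp add: choose_gf_at_0 geom_def lgs_def fps_nth_power_0)
qed

lemma choose_gf_3: "choose_gf 3 = (24 * geom^4 - 24 * geom^3 + 4 * geom^2) * lgs^3
    + (16 * geom^2 - 12 * geom^4 - 20 * geom^3) * lgs^2
    + (36 * geom^4 - 40 * geom^3 + 24 * geom^2) * lgs
    + (14 * geom^2 - 6 * geom^4 - 8 * geom^3)" (is "_ = ?G")
proof (rule fps_linear_ode_unique)
  let ?B = "8 * choose_gf 1 * choose_gf 2
    + 4 * (falling_deriv 1 geom * choose_gf 2 + geom * falling_deriv 1 (choose_gf 2)
       + 6 * choose_gf 1 * falling_deriv 1 (choose_gf 1))
    + 8 * (falling_deriv 2 geom * choose_gf 1 + falling_deriv 1 geom * falling_deriv 1 (choose_gf 1)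
       + geom * falling_deriv 2 (choose_gf 1))
    + 2 * (falling_deriv 3 geom * geom + falling_deriv 2 geom * falling_deriv 1 geom)"
  show "fps_deriv (choose_gf 3) = 2 * geom * choose_gf 3 + ?B"
    by (simp add: choose_gf_ode numeral_2_eq_2 numeral_3_eq_3 algebra_simps flip: numeral_fps_const)
  show "fps_deriv ?G = 2 * geom * ?G + ?B"
    unfolding choose_gf_1 choose_gf_2 falling_deriv_1 falling_deriv_3 falling_deriv_2
    by (simp add: theta_simps theta_geom theta_lgs fps_deriv_power fps_deriv_geom fps_deriv_lgs flip: numeral_fps_const) algebra
  show "choose_gf 3 $ 0 = ?G $ 0"
    by (simp add: choose_gf_at_0 geom_def lgs_def fps_nth_power_0)
qed

lemma choose_gf_4: "choose_gf 4 = (720 * geom^5 - 1080 * geom^4 + 420 * geom^3 - 30 * geom^2) * lgs^4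
    + (240 * geom^5 - 2160 * geom^4 + 2040 * geom^3 - 360 * geom^2) * lgs^3
    + (1800 * geom^5 - 3420 * geom^4 + 3680 * geom^3 - 1300 * geom^2) * lgs^2
    + (360 * geom^5 - 3180 * geom^4 + 3760 * geom^3 - 1936 * geom^2) * lgs
    + (428 * geom^5 - 1018 * geom^4 + 1744 * geom^3 - 1150 * geom^2 - 4 * geom)" (is "_ = ?G")
proof (rule fps_linear_ode_unique)
  let ?B = "60 * choose_gf 1 * choose_gf 3 + 20 * choose_gf 2 ^ 2
    + (30 * (falling_deriv 1 geom * choose_gf 3 + geom * falling_deriv 1 (choose_gf 3))
       + 120 * (falling_deriv 1 (choose_gf 1) * choose_gf 2 + choose_gf 1 * falling_deriv 1 (choose_gf 2)))
    + (40 * (falling_deriv 2 geom * choose_gf 2 + falling_deriv 1 geom * falling_deriv 1 (choose_gf 2)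
         + geom * falling_deriv 2 (choose_gf 2))
       + 120 * (2 * choose_gf 1 * falling_deriv 2 (choose_gf 1) + (falling_deriv 1 (choose_gf 1))^2))
    + 60 * (falling_deriv 3 geom * choose_gf 1 + falling_deriv 2 geom * falling_deriv 1 (choose_gf 1)
       + falling_deriv 1 geom * falling_deriv 2 (choose_gf 1) + geom * falling_deriv 3 (choose_gf 1))
    + 6 * (2 * falling_deriv 4 geom * geom + 2 * falling_deriv 3 geom * falling_deriv 1 geom
       + (falling_deriv 2 geom)^2)"
  show "fps_deriv (choose_gf 4) = 2 * geom * choose_gf 4 + ?B"
    by (simp add: choose_gf_ode eval_nat_numeral algebra_simps flip: numeral_fps_const)
  show "fps_deriv ?G = 2 * geom * ?G + ?B"
    unfolding choose_gf_1 choose_gf_2 choose_gf_3 falling_deriv_1 falling_deriv_4 falling_deriv_3 falling_deriv_2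
    by (simp add: theta_simps theta_geom theta_lgs fps_deriv_power fps_deriv_geom fps_deriv_lgs flip: numeral_fps_const) algebra
  show "choose_gf 4 $ 0 = ?G $ 0"
    by (simp add: choose_gf_at_0 geom_def lgs_def fps_nth_power_0)
qed

section \<open>Coefficients and harmonic sums\<close>

text \<open>
  Multiplication by \<open>geom\<close> forms partial sums, and the coefficients of \<open>lgs^b\<close> are known from its
  derivative \<open>b geom lgs^(b-1)\<close>.
\<close>

lemma geom_lgs_nth_Suc:
  "(geom * lgs ^ b) $ Suc n =
    (geom * lgs ^ b) $ n + real b * (1 / real (Suc n)) * (geom * lgs ^ (b - 1)) $ n"
proof -
  have "fps_X * (geom * lgs ^ b) = geom * lgs ^ b - lgs ^ b"
    by (simp only: mult.assoc[symmetric] fps_X_geom) (simp add: algebra_simps)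
  from arg_cong[OF this, of "\<lambda>F. F $ Suc n"]
  have "(geom * lgs ^ b) $ Suc n = (geom * lgs ^ b) $ n + (lgs ^ b) $ Suc n"
    by simp
  moreover have "fps_deriv (lgs ^ b) = of_nat b * (geom * lgs ^ (b - 1))"
    by (simp add: fps_deriv_power fps_deriv_lgs fps_of_nat mult_ac)
  from arg_cong[OF this, of "\<lambda>F. F $ n"]
  have "real (Suc n) * (lgs ^ b) $ Suc n = real b * (geom * lgs ^ (b - 1)) $ n"
    by (simp flip: fps_of_nat)
  ultimately show ?thesis by (simp add: field_simps)
qed

text \<open>
  This compares the coefficients in \<open>theta (u^a L^b) = a (u - 1) u^a L^b + b (u - 1) u^a L^(b-1)\<close>. It
  lowers the exponent of \<open>u\<close> without changing \<open>n\<close>, so no shifted harmonic numbers arise.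
\<close>

lemma geom_power_lgs_nth:
  assumes "a > 0"
  shows "(geom ^ Suc a * lgs ^ b) $ n =
    ((real n + real a) * (geom ^ a * lgs ^ b) $ n -
      real b * ((geom ^ Suc a * lgs ^ (b - 1)) $ n - (geom ^ a * lgs ^ (b - 1)) $ n)) / real a"
proof -
  let ?F = "geom ^ a * lgs ^ b" and ?G = "\<lambda>a. geom ^ a * lgs ^ (b - 1)"
  have "theta ?F = of_nat a * (geom ^ Suc a * lgs ^ b) - of_nat a * ?F + of_nat b * (?G (Suc a) - ?G a)"
    using assms unfolding theta_simps theta_geom theta_lgs
    by (cases a) (simp_all add: algebra_simps del: of_nat_Suc)
  then have "theta ?F $ n = real a * (geom ^ Suc a * lgs ^ b) $ n - real a * ?F $ n
      + real b * (?G (Suc a) $ n - ?G a $ n)"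
    by (simp only: fps_add_nth fps_sub_nth fps_of_nat[symmetric] fps_mult_left_const_nth)
  moreover have "theta ?F $ n = real n * ?F $ n"
    by (rule theta_nth)
  ultimately show ?thesis using assms by (simp add: field_simps)
qed

lemma harm_pow_Suc: "harm_pow k (Suc n) = harm_pow k n + (1 / real (Suc n)) ^ k"
  by (simp add: harm_pow_def power_one_over)

text \<open>
  The coefficient is \<open>b!\<close> times the \<open>b\<close>-th elementary symmetric polynomial of \<open>1, 1/2, ..., 1/n\<close>, as
  the recurrence \<open>geom_lgs_nth_Suc\<close> shows; the right-hand sides express it by power sums as in
  Newton's identities.
\<close>

lemma geom_lgs_nth:
  "(geom * lgs ^ 0) $ n = 1"
  "(geom * lgs ^ 1) $ n = harm_pow 1 n"
  "(geom * lgs ^ 2) $ n = harm_pow 1 n ^ 2 - harm_pow 2 n"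
  "(geom * lgs ^ 3) $ n = harm_pow 1 n ^ 3 - 3 * harm_pow 1 n * harm_pow 2 n + 2 * harm_pow 3 n"
  "(geom * lgs ^ 4) $ n = harm_pow 1 n ^ 4 - 6 * harm_pow 1 n ^ 2 * harm_pow 2 n
     + 3 * harm_pow 2 n ^ 2 + 8 * harm_pow 1 n * harm_pow 3 n - 6 * harm_pow 4 n"
proof -
  let ?c = "\<lambda>b n. (geom * lgs ^ b) $ n"
  have zero: "?c b 0 = (if b = 0 then 1 else 0)" for b
    by (simp add: geom_def lgs_def fps_nth_power_0)
  have lgs0: "lgs $ 0 = 0" by (simp add: lgs_def)
  have h0: "harm_pow k 0 = 0" for k by (simp add: harm_pow_def)
  \<comment> \<open>Keeping \<open>1 / (n + 1)\<close> opaque turns each induction step into an identity of polynomials in \<open>x n\<close>.\<close>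
  define x where "x n = 1 / real (Suc n)" for n
  have rec: "?c b (Suc n) = ?c b n + real b * x n * ?c (b - 1) n" for b n
    using geom_lgs_nth_Suc[of b n] by (simp add: x_def)
  have harm: "harm_pow 1 (Suc n) = harm_pow 1 n + x n" "harm_pow k (Suc n) = harm_pow k n + x n ^ k" for k n
    by (simp_all add: harm_pow_Suc x_def)
  show c0: "?c 0 n = 1" for n by (simp add: geom_def)
  show c1: "?c 1 n = harm_pow 1 n" for n
    by (induction n) (simp_all only: zero rec harm h0, simp_all add: c0[simplified])
  show c2: "?c 2 n = harm_pow 1 n ^ 2 - harm_pow 2 n" for n
  proof (induction n)
    case (Suc n)
    have "?c 2 (Suc n) = ?c 2 n + 2 * x n * ?c 1 n" using rec[of 2 n] by simp
    then show ?case unfolding Suc c1 harm by algebra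
  qed (simp add: zero h0 lgs0)
  show c3: "?c 3 n = harm_pow 1 n ^ 3 - 3 * harm_pow 1 n * harm_pow 2 n + 2 * harm_pow 3 n" for n
  proof (induction n)
    case (Suc n)
    have "?c 3 (Suc n) = ?c 3 n + 3 * x n * ?c 2 n" using rec[of 3 n] by simp
    then show ?case unfolding Suc c2 harm by algebra
  qed (simp add: zero h0 lgs0)
  show "?c 4 n = harm_pow 1 n ^ 4 - 6 * harm_pow 1 n ^ 2 * harm_pow 2 n
     + 3 * harm_pow 2 n ^ 2 + 8 * harm_pow 1 n * harm_pow 3 n - 6 * harm_pow 4 n" for n
  proof (induction n)
    case (Suc n)
    have "?c 4 (Suc n) = ?c 4 n + 4 * x n * ?c 3 n" using rec[of 4 n] by simp
    then show ?case unfolding Suc c3 harm by algebra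
  qed (simp add: zero h0 lgs0)
qed

lemma nth_numeral_mult: "(numeral k * F :: real fps) $ n = numeral k * F $ n"
  by (simp only: numeral_fps_const fps_mult_left_const_nth)

text \<open>
  Every coefficient of \<open>u^a L^b\<close> is reduced to the \<open>E b\<close>, with factors polynomial in \<open>n\<close>.
  The factors \<open>2\<close> and \<open>3\<close> on the left clear the denominators that this introduces.
\<close>

lemma choose_gf_nth:
  fixes n :: nat
  defines "N \<equiv> real n" and "E \<equiv> \<lambda>b. (geom * lgs ^ b) $ n"
  shows "choose_gf 1 $ n = (N + 1) * E 1 - 2 * N"
    and "2 * choose_gf 2 $ n = (6 * N^2 + 12 * N + 6) * E 2 - (24 * N^2 + 32 * N + 8) * E 1
      + (35 * N^2 + 29 * N)"
    and "3 * choose_gf 3 $ n = (12 * N^3 + 36 * N^2 + 36 * N + 12) * E 3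
      - (72 * N^3 + 192 * N^2 + 168 * N + 48) * E 2
      + (210 * N^3 + 480 * N^2 + 330 * N + 60) * E 1 - (256 * N^3 + 528 * N^2 + 296 * N)"
    and "3 * choose_gf 4 $ n = (90 * N^4 + 360 * N^3 + 540 * N^2 + 360 * N + 90) * E 4
      - (720 * N^4 + 2880 * N^3 + 4320 * N^2 + 2880 * N + 720) * E 3
      + (3150 * N^4 + 11790 * N^3 + 16410 * N^2 + 10050 * N + 2280) * E 2
      - (7680 * N^4 + 27720 * N^3 + 36000 * N^2 + 18948 * N + 2988) * E 1
      + (8576 * N^4 + 30011 * N^3 + 37372 * N^2 + 17377 * N)"
proof -
  define c where "c a b = (geom ^ a * lgs ^ b) $ n" for a b
  have base: "c (Suc 0) b = E b" for b by (simp add: c_def E_def)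
  have E0: "E 0 = 1" unfolding E_def by (rule geom_lgs_nth)
  have rec0: "c (Suc (Suc a)) 0 = (N + real (Suc a)) * c (Suc a) 0 / real (Suc a)" for a
    using geom_power_lgs_nth[of "Suc a" 0 n] by (simp add: c_def N_def)
  have recS: "c (Suc (Suc a)) (Suc b) = ((N + real (Suc a)) * c (Suc a) (Suc b)
      - real (Suc b) * (c (Suc (Suc a)) b - c (Suc a) b)) / real (Suc a)" for a b
    using geom_power_lgs_nth[of "Suc a" "Suc b" n] unfolding c_def N_def by simp
  have norm: "(geom ^ a * lgs ^ b) $ n = c a b" "(geom * lgs ^ b) $ n = c (Suc 0) b"
    "(geom ^ a * lgs) $ n = c a (Suc 0)" "(geom ^ a) $ n = c a 0" "geom $ n = c (Suc 0) 0" for a b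
    by (simp_all add: c_def)
  note red = fps_add_nth fps_sub_nth ring_distribs mult.assoc nth_numeral_mult norm
  \<comment> \<open>With numerals unfolded to successors, \<open>rec0\<close> and \<open>recS\<close> are terminating rewrite rules down to \<open>base\<close>.\<close>
  note vals = base E0 rec0 recS eval_nat_numeral
  show "choose_gf 1 $ n = (N + 1) * E 1 - 2 * N"
    by (simp only: choose_gf_1 red) (simp add: vals algebra_simps)
  show "2 * choose_gf 2 $ n = (6 * N^2 + 12 * N + 6) * E 2 - (24 * N^2 + 32 * N + 8) * E 1
      + (35 * N^2 + 29 * N)"
    by (simp only: choose_gf_2 red, simp add: vals) (simp add: field_simps)
  show "3 * choose_gf 3 $ n = (12 * N^3 + 36 * N^2 + 36 * N + 12) * E 3
      - (72 * N^3 + 192 * N^2 + 168 * N + 48) * E 2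
      + (210 * N^3 + 480 * N^2 + 330 * N + 60) * E 1 - (256 * N^3 + 528 * N^2 + 296 * N)"
    by (simp only: choose_gf_3 red, simp add: vals) (simp add: field_simps)
  show "3 * choose_gf 4 $ n = (90 * N^4 + 360 * N^3 + 540 * N^2 + 360 * N + 90) * E 4
      - (720 * N^4 + 2880 * N^3 + 4320 * N^2 + 2880 * N + 720) * E 3
      + (3150 * N^4 + 11790 * N^3 + 16410 * N^2 + 10050 * N + 2280) * E 2
      - (7680 * N^4 + 27720 * N^3 + 36000 * N^2 + 18948 * N + 2988) * E 1
      + (8576 * N^4 + 30011 * N^3 + 37372 * N^2 + 17377 * N)"
    by (simp only: choose_gf_4 red, simp add: vals) (simp add: field_simps)
qed

text \<open>
  The polynomial identity that remains: \<open>E2, E3, E4\<close> stand for the coefficients of \<open>u L^b\<close>, and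
  \<open>C1, ..., C4\<close> for the binomial moments.
\<close>

lemma fourth_central_moment_in_harmonic_sums:
  fixes N h1 h2 h3 h4 C1 C2 C3 C4 :: real
  assumes "E2 = h1 ^ 2 - h2" "E3 = h1 ^ 3 - 3 * h1 * h2 + 2 * h3"
    "E4 = h1 ^ 4 - 6 * h1 ^ 2 * h2 + 3 * h2 ^ 2 + 8 * h1 * h3 - 6 * h4"
    and C1: "C1 = (N + 1) * h1 - 2 * N"
    and C2: "2 * (6 * C2) = (6 * N^2 + 12 * N + 6) * E2 - (24 * N^2 + 32 * N + 8) * h1
      + (35 * N^2 + 29 * N)"
    and C3: "3 * (24 * C3) = (12 * N^3 + 36 * N^2 + 36 * N + 12) * E3
      - (72 * N^3 + 192 * N^2 + 168 * N + 48) * E2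
      + (210 * N^3 + 480 * N^2 + 330 * N + 60) * h1 - (256 * N^3 + 528 * N^2 + 296 * N)"
    and C4: "3 * (720 * C4) = (90 * N^4 + 360 * N^3 + 540 * N^2 + 360 * N + 90) * E4
      - (720 * N^4 + 2880 * N^3 + 4320 * N^2 + 2880 * N + 720) * E3
      + (3150 * N^4 + 11790 * N^3 + 16410 * N^2 + 10050 * N + 2280) * E2
      - (7680 * N^4 + 27720 * N^3 + 36000 * N^2 + 18948 * N + 2988) * h1
      + (8576 * N^4 + 30011 * N^3 + 37372 * N^2 + 17377 * N)"
  shows "(24 * C4 + 36 * C3 + 14 * C2 + C1) - 4 * C1 * (6 * C3 + 6 * C2 + C1)
       + 6 * C1 ^ 2 * (2 * C2 + C1) - 3 * C1 ^ 4 =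
      1 / 90 * N * (1496 * N ^ 3 + 5531 * N ^ 2 + 8527 * N + 6922)
      - 1 / 15 * (N + 1) * (55 * N ^ 2 + 85 * N + 173) * h1
      + 1 / 3 * (N + 1) ^ 2 * h1 ^ 2
      + (- (1 / 3) * (33 * N ^ 2 + 51 * N + 25) * (N + 1) ^ 2
          + 2 * (N + 1) ^ 3 * h1) * h2
      + 3 * (N + 1) ^ 4 * h2 ^ 2
      - 4 * (N + 1) ^ 3 * h3
      - 6 * (N + 1) ^ 4 * h4"
proof -
  have C2': "C2 = ((6 * N^2 + 12 * N + 6) * E2 - (24 * N^2 + 32 * N + 8) * h1
      + (35 * N^2 + 29 * N)) / 12" using C2 by simp
  have C3': "C3 = ((12 * N^3 + 36 * N^2 + 36 * N + 12) * E3
      - (72 * N^3 + 192 * N^2 + 168 * N + 48) * E2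
      + (210 * N^3 + 480 * N^2 + 330 * N + 60) * h1 - (256 * N^3 + 528 * N^2 + 296 * N)) / 72"
    using C3 by simp
  have C4': "C4 = ((90 * N^4 + 360 * N^3 + 540 * N^2 + 360 * N + 90) * E4
      - (720 * N^4 + 2880 * N^3 + 4320 * N^2 + 2880 * N + 720) * E3
      + (3150 * N^4 + 11790 * N^3 + 16410 * N^2 + 10050 * N + 2280) * E2
      - (7680 * N^4 + 27720 * N^3 + 36000 * N^2 + 18948 * N + 2988) * h1
      + (8576 * N^4 + 30011 * N^3 + 37372 * N^2 + 17377 * N)) / 2160"
    using C4 by simp
  show ?thesis unfolding C1 C2' C3' C4' assms(1-3) by (simp add: divide_simps) algebra
qed

section \<open>Moments of the number of swaps\<close>

text \<open>
  Only points on one side of \<open>0\<close> are used, since a probability generating function is given on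
  \<open>[0, 1]\<close>. Once the lower coefficients vanish, \<open>d m\<close> is the limit of the series divided by \<open>t^m\<close> as
  \<open>t\<close> tends to \<open>0\<close>.
\<close>

lemma powser_eq_0_imp_coeffs_0:
  fixes d :: "nat \<Rightarrow> real"
  assumes "\<And>t. 0 < t \<Longrightarrow> t < 1 \<Longrightarrow> (\<lambda>m. d m * t ^ m) sums 0"
  shows "d m = 0"
proof (induction m rule: less_induct)
  case (less m)
  define g where "g t = (\<Sum>k. d (k + m) * t ^ k)" for t
  have sums0: "(\<lambda>k. d (k + m) * t ^ k) sums 0" if t: "0 < t" "t < 1" for t
  proof -
    have "(\<lambda>k. d (k + m) * t ^ (k + m)) sums (0 - (\<Sum>k<m. d k * t ^ k))"
      by (rule sums_split_initial_segment[OF assms[OF t]])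
    then have "(\<lambda>k. t ^ m * (d (k + m) * t ^ k)) sums (t ^ m * 0)"
      using less by (simp add: power_add mult_ac)
    then show ?thesis using t by (subst (asm) sums_mult_iff) auto
  qed
  have "(g \<longlongrightarrow> d (0 + m)) (at 0)"
  proof (rule powser_limit_0)
    fix t :: real assume "norm t < 1 / 2"
    then have "summable (\<lambda>k. d (k + m) * t ^ k)"
      using sums0[of "1 / 2"] by (intro powser_inside[of _ "1 / 2" t]) (auto simp: sums_iff)
    then show "(\<lambda>k. d (k + m) * t ^ k) sums g t" by (simp add: g_def summable_sums)
  qed auto
  then have "(g \<longlongrightarrow> d m) (at_right 0)"
    by (simp add: filterlim_at_split)
  moreover have "(g \<longlongrightarrow> 0) (at_right 0)"
  proof (rule tendsto_eventually)
    show "\<forall>\<^sub>F t in at_right 0. g t = 0"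
      unfolding eventually_at_right_field
      using sums0 by (intro exI[of _ 1]) (auto simp: g_def sums_iff)
  qed
  ultimately show ?case
    by (rule tendsto_unique[OF trivial_limit_at_right_real])
qed

text \<open>
  The generating function determines the distribution, so expectations can be computed with a
  finitely supported one.
\<close>

lemma is_swap_count_distr:
  assumes "is_swap_count M X n" "finite (set_pmf q)"
    and q: "\<And>t. pgf (measure_pmf q) (\<lambda>x. x) t = swaps_pgf n t"
  shows "distr M (count_space UNIV) X = measure_pmf q"
proof -
  interpret prob_space M using assms(1) by (simp add: is_swap_count_def)
  have X: "X \<in> measurable M (count_space UNIV)"
    and pgf: "\<And>t. t \<in> {0..1} \<Longrightarrow> pgf M X t = swaps_pgf n t"
    using assms(1) by (auto simp: is_swap_count_def)
  let ?p = "\<lambda>m. prob {\<omega> \<in> space M. X \<omega> = m}"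
  have eq: "?p m = pmf q m" for m
  proof -
    have "?p m - pmf q m = 0"
    proof (rule powser_eq_0_imp_coeffs_0)
      fix t :: real assume t: "0 < t" "t < 1"
      have sm: "summable (\<lambda>m. a m * t ^ m)" if "\<And>m. 0 \<le> a m \<and> a m \<le> 1" for a :: "nat \<Rightarrow> real"
        using t that by (intro summable_comparison_test'[OF summable_geometric[of t]])
          (auto simp: mult_left_le_one_le)
      have "(\<lambda>m. ?p m * t ^ m) sums swaps_pgf n t"
        using sm[of ?p] pgf[of t] t by (auto simp: pgf_def sums_iff)
      moreover have "(\<lambda>m. pmf q m * t ^ m) sums swaps_pgf n t"
        using sm[of "pmf q"] q[of t]
        by (auto simp: pgf_def sums_iff pmf_le_1 measure_pmf_single)
      ultimately have "(\<lambda>m. ?p m * t ^ m - pmf q m * t ^ m) sums (swaps_pgf n t - swaps_pgf n t)"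
        by (rule sums_diff)
      then show "(\<lambda>m. (?p m - pmf q m) * t ^ m) sums 0" by (simp add: algebra_simps)
    qed
    then show ?thesis by simp
  qed
  show ?thesis
  proof (rule measure_eqI_countable[of _ UNIV])
    fix m :: nat
    have "emeasure (distr M (count_space UNIV) X) {m} = emeasure M {\<omega> \<in> space M. X \<omega> = m}"
      using X by (subst emeasure_distr) (auto intro!: arg_cong2[where f = emeasure])
    then show "emeasure (distr M (count_space UNIV) X) {m} = emeasure (measure_pmf q) {m}"
      by (simp add: emeasure_eq_measure eq emeasure_pmf_single)
  qed auto
qed

text \<open>
  Both sides are the coefficient of \<open>x^r\<close> in \<open>E[(1 + x)^X]\<close>.
\<close>

lemma expectation_choose_swaps_poly:
  assumes "finite (set_pmf q)"
    and q: "\<And>t. pgf (measure_pmf q) (\<lambda>x. x) t = swaps_pgf n t"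
  shows "(\<Sum>x\<in>set_pmf q. pmf q x * real (x choose r)) = coeff (swaps_poly n) r"
proof -
  have "(\<Sum>x\<in>set_pmf q. smult (pmf q x) ([:1, 1:] ^ x)) = swaps_poly n"
  proof (rule poly_ext)
    fix e
    have "swaps_pgf n (1 + e) = measure_pmf.expectation q (\<lambda>x. (1 + e) ^ x)"
      using pgf_finite_support[OF assms(1), of "\<lambda>x. x" "1 + e"] q[of "1 + e"] by simp
    also have "\<dots> = (\<Sum>x\<in>set_pmf q. pmf q x * (1 + e) ^ x)"
      using assms(1) by (subst integral_measure_pmf[of "set_pmf q"]) (auto simp: mult_ac)
    finally show "poly (\<Sum>x\<in>set_pmf q. smult (pmf q x) ([:1, 1:] ^ x)) e = poly (swaps_poly n) e"
      by (simp add: poly_swaps_poly poly_sum poly_power)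
  qed
  moreover have "coeff ([:1, 1:] ^ x) r = real (x choose r)" for x
    by (cases "r \<le> x")
      (simp_all add: coeff_linear_poly_power coeff_eq_0 degree_linear_power binomial_eq_0)
  ultimately show ?thesis by (simp flip: \<open>_ = swaps_poly n\<close> add: coeff_sum)
qed

text \<open>
  The coefficients are \<open>r! S(m, r)\<close> with Stirling numbers \<open>S(m, r)\<close> of the second kind.
\<close>

lemma power_eq_choose_sums:
  fixes x :: nat
  shows "real x ^ 2 = 2 * real (x choose 2) + x"
    and "real x ^ 3 = 6 * real (x choose 3) + 6 * real (x choose 2) + x"
    and "real x ^ 4 = 24 * real (x choose 4) + 36 * real (x choose 3) + 14 * real (x choose 2) + x"
  unfolding binomial_gbinomial gbinomial_prod_rev
  by (simp_all add: eval_nat_numeral) (simp_all add: field_simps)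

lemma fourth_central_moment_eq_choose_moments:
  assumes "is_swap_count M X n"
  defines "C \<equiv> \<lambda>r. coeff (swaps_poly n) r"
  shows "prob_space.expectation M (\<lambda>\<omega>. real (X \<omega>)) = C 1"
    and "prob_space.expectation M (\<lambda>\<omega>. (real (X \<omega>) - C 1) ^ 4) =
       (24 * C 4 + 36 * C 3 + 14 * C 2 + C 1) - 4 * C 1 * (6 * C 3 + 6 * C 2 + C 1)
       + 6 * C 1 ^ 2 * (2 * C 2 + C 1) - 3 * C 1 ^ 4"
proof -
  obtain q where fin: "finite (set_pmf q)"
    and q: "\<And>t. pgf (measure_pmf q) (\<lambda>x. x) t = swaps_pgf n t"
    using ex_swap_count_pmf by blast
  have X: "X \<in> measurable M (count_space UNIV)" using assms(1) by (simp add: is_swap_count_def)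
  have E: "integral\<^sup>L M (\<lambda>\<omega>. g (X \<omega>)) = (\<Sum>x\<in>set_pmf q. pmf q x * g x)" for g :: "nat \<Rightarrow> real"
  proof -
    have "integral\<^sup>L M (\<lambda>\<omega>. g (X \<omega>)) = integral\<^sup>L (measure_pmf q) g"
      unfolding is_swap_count_distr[OF assms(1) fin q, symmetric]
      using X by (subst integral_distr) auto
    also have "\<dots> = (\<Sum>x\<in>set_pmf q. pmf q x * g x)"
      using fin by (subst integral_measure_pmf[of "set_pmf q"]) auto
    finally show ?thesis .
  qed
  have C: "(\<Sum>x\<in>set_pmf q. pmf q x * real (x choose r)) = C r" for r
    unfolding C_def by (rule expectation_choose_swaps_poly[OF fin q])
  have one: "(\<Sum>x\<in>set_pmf q. pmf q x) = 1" using fin by (simp add: sum_pmf_eq_1)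
  show mean: "prob_space.expectation M (\<lambda>\<omega>. real (X \<omega>)) = C 1"
    using C[of 1] by (simp add: E)
  \<comment> \<open>An arbitrary centre \<open>c\<close>, as the mean is itself a sum over the support and must stay a constant here.\<close>
  have "prob_space.expectation M (\<lambda>\<omega>. (real (X \<omega>) - c) ^ 4) =
      24 * C 4 + (36 - 24 * c) * C 3 + (14 - 24 * c + 12 * c ^ 2) * C 2
      + (1 - 4 * c + 6 * c ^ 2 - 4 * c ^ 3) * C 1 + c ^ 4 * (\<Sum>x\<in>set_pmf q. pmf q x)" for c
    unfolding E[of "\<lambda>x. (real x - c) ^ 4"] C[symmetric] sum_distrib_left sum.distrib[symmetric]
  proof (intro sum.cong refl)
    fix x
    have expand: "(real x - c) ^ 4 = real x ^ 4 - 4 * c * real x ^ 3 + 6 * c ^ 2 * real x ^ 2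
        - 4 * c ^ 3 * real x + c ^ 4"
      by algebra
    show "pmf q x * (real x - c) ^ 4 =
        24 * (pmf q x * real (x choose 4)) + (36 - 24 * c) * (pmf q x * real (x choose 3))
        + (14 - 24 * c + 12 * c ^ 2) * (pmf q x * real (x choose 2))
        + (1 - 4 * c + 6 * c ^ 2 - 4 * c ^ 3) * (pmf q x * real (x choose 1)) + c ^ 4 * pmf q x"
      unfolding expand power_eq_choose_sums by (simp add: algebra_simps)
  qed
  from this[of "C 1", unfolded one]
  show "prob_space.expectation M (\<lambda>\<omega>. (real (X \<omega>) - C 1) ^ 4) =
       (24 * C 4 + 36 * C 3 + 14 * C 2 + C 1) - 4 * C 1 * (6 * C 3 + 6 * C 2 + C 1)
       + 6 * C 1 ^ 2 * (2 * C 2 + C 1) - 3 * C 1 ^ 4"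
    by algebra
qed

theorem theorem4p12:
  fixes M :: "'a measure" and X :: "'a \<Rightarrow> nat" and n :: nat
  assumes "n \<ge> 1"
    and "is_swap_count M X n"
  shows "prob_space.expectation M
      (\<lambda>\<omega>. (real (X \<omega>) - prob_space.expectation M (\<lambda>\<omega>. real (X \<omega>))) ^ 4) =
      1 / 90 * real n * (1496 * real n ^ 3 + 5531 * real n ^ 2 + 8527 * real n + 6922)
      - 1 / 15 * (real n + 1) * (55 * real n ^ 2 + 85 * real n + 173) * harm_pow 1 n
      + 1 / 3 * (real n + 1) ^ 2 * harm_pow 1 n ^ 2
      + (- (1 / 3) * (33 * real n ^ 2 + 51 * real n + 25) * (real n + 1) ^ 2
          + 2 * (real n + 1) ^ 3 * harm_pow 1 n) * harm_pow 2 n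
      + 3 * (real n + 1) ^ 4 * harm_pow 2 n ^ 2
      - 4 * (real n + 1) ^ 3 * harm_pow 3 n
      - 6 * (real n + 1) ^ 4 * harm_pow 4 n"
proof -
  let ?h = "\<lambda>k. harm_pow k n" and ?C = "\<lambda>r. coeff (swaps_poly n) r"
  have nth: "choose_gf r $ n = moment_scale r * ?C r" for r by (simp add: choose_gf_def)
  show ?thesis
    unfolding fourth_central_moment_eq_choose_moments[OF assms(2)]
    using fourth_central_moment_in_harmonic_sums[OF refl refl refl,
        of "?C 1" "real n" "?h 1" "?C 2" "?h 2" "?C 3" "?h 3" "?C 4" "?h 4"]
      choose_gf_nth[of n] geom_lgs_nth[of n]
    by (simp add: nth moment_scale_def)
qed

end
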